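(* Let $N$, $n$ and $k$ be non-negative integers. Then \[\mathcal{A}_{N}(n,k) = \mathcal{B}_{N}(n,k),\] where $\mathcal{A}_{N}(n,k)$ is the number of partitions of $n$ into no more than $N$ parts, where exactly $k$ parts are odd, and $\mathcal{B}_{N}(n,k)$ is the number of partitions of $n$ into parts $\leq N$, where the alternating sum of parts is equal to $k$.
   Context: A partition $\pi=(\lambda_1,\lambda_2,\dots,\lambda_m)$ is a finite non-increasing sequence of positive integers (its parts, possibly repeated); it is a partition of $n$ if the parts sum to $n$; the empty sequence is the unique partition of $0$. The alternating sum of parts of $\pi$ is $\gamma(\pi)=\lambda_1-\lambda_2+\lambda_3-\lambda_4+\dots+(-1)^{m+1}\lambda_m$ (equal to $0$ for the empty partition). *)

theory Defs
  imports Main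
begin

definition is_partition :: "nat list \<Rightarrow> bool" where
  "is_partition p \<longleftrightarrow> sorted_wrt (\<ge>) p \<and> (\<forall>x\<in>set p. 0 < x)"

definition partitions_of :: "nat \<Rightarrow> nat list set" where
  "partitions_of n = {p. is_partition p \<and> sum_list p = n}"

(* List positions start at 0, so the largest part p ! 0 gets sign +.
   The sum is taken in int to avoid truncated subtraction. *)
definition alt_sum :: "nat list \<Rightarrow> int" where
  "alt_sum p = (\<Sum>i<length p. (-1) ^ i * int (p ! i))"

(* Odd parts are counted with multiplicity. *)
definition A_count :: "nat \<Rightarrow> nat \<Rightarrow> nat \<Rightarrow> nat" where
  "A_count N n k =
     card {p \<in> partitions_of n. length p \<le> N \<and> length (filter odd p) = k}"

definition B_count :: "nat \<Rightarrow> nat \<Rightarrow> nat \<Rightarrow> nat" where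
  "B_count N n k =
     card {p \<in> partitions_of n. (\<forall>x\<in>set p. x \<le> N) \<and> alt_sum p = int k}"

(* Hence card in A_count and B_count is the genuine number of elements. *)
lemma finite_partitions_of: "finite (partitions_of n)"
proof (rule finite_subset)
  have len: "length p \<le> sum_list p" if "\<forall>x\<in>set p. 0 < x" for p :: "nat list"
    using that by (induction p) (auto simp: Suc_le_eq)
  show "partitions_of n \<subseteq> {p. set p \<subseteq> {..n} \<and> length p \<le> n}"
    using len by (auto simp: partitions_of_def is_partition_def member_le_sum_list)
  show "finite {p. set p \<subseteq> {..n} \<and> length p \<le> n}"
    by (rule finite_lists_length_le) simp
qed

end

theory Submission
  imports Defs
begin

text \<open>
  Conjugation of Young diagrams exchanges the number of parts with the largest part. A part of
  size \<open>x\<close> of \<open>p\<close> contributes one box to each of the first \<open>x\<close> parts of the conjugate, hence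
  \<open>1 - 1 + 1 - \<dots>\<close> (\<open>x\<close> terms) to its alternating sum, which is 1 or 0 according to the parity
  of \<open>x\<close>. So the alternating sum of the conjugate counts the odd parts of \<open>p\<close>.
\<close>

text \<open>Inserting 0 gives the empty partition the value 0 and changes nothing otherwise.\<close>

definition largest_part :: "nat list \<Rightarrow> nat" where
  "largest_part p = Max (insert 0 (set p))"

text \<open>Entry \<open>i\<close> is the height of column \<open>i\<close> of the Young diagram,
  columns being counted from 0.\<close>

definition conjugate :: "nat list \<Rightarrow> nat list" where
  "conjugate p = map (\<lambda>i. length (filter (\<lambda>x. i < x) p)) [0..<largest_part p]"

lemma largest_part_le_iff: "largest_part p \<le> m \<longleftrightarrow> (\<forall>x\<in>set p. x \<le> m)"
  by (simp add: largest_part_def)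

lemma less_largest_part_iff: "i < largest_part p \<longleftrightarrow> (\<exists>x\<in>set p. i < x)"
  by (simp add: largest_part_def Max_gr_iff)

lemma length_conjugate [simp]: "length (conjugate p) = largest_part p"
  by (simp add: conjugate_def)

lemma nth_conjugate [simp]:
  "i < largest_part p \<Longrightarrow> conjugate p ! i = length (filter (\<lambda>x. i < x) p)"
  by (simp add: conjugate_def)

text \<open>Double counting: give each box in column \<open>i\<close> the weight \<open>f i\<close>
  and add up by columns or by rows. Weight 1 yields the size of the conjugate, weight
  \<open>(-1) ^ i\<close> its alternating sum.\<close>

lemma sum_mult_length_filter_less:
  fixes f :: "nat \<Rightarrow> 'a::comm_semiring_1"
  assumes "\<forall>x\<in>set p. x \<le> m"
  shows "(\<Sum>i<m. f i * of_nat (length (filter (\<lambda>x. i < x) p))) = (\<Sum>x\<leftarrow>p. \<Sum>i<x. f i)"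
  using assms
proof (induction p)
  case (Cons y p)
  have "{..<m} \<inter> {i. i < y} = {..<y}"
    using Cons.prems by auto
  then have "(\<Sum>i<y. f i) = (\<Sum>i<m. if i < y then f i else 0)"
    by (simp add: sum.If_cases)
  moreover have "f i * of_nat (length (filter (\<lambda>x. i < x) (y # p))) =
      (if i < y then f i else 0) + f i * of_nat (length (filter (\<lambda>x. i < x) p))" for i
    by (simp add: algebra_simps)
  ultimately show ?case
    using Cons by (simp add: sum.distrib)
qed simp

lemma sum_list_conjugate: "sum_list (conjugate p) = sum_list p"
  using sum_mult_length_filter_less[of p "largest_part p" "\<lambda>_. 1 :: nat"] largest_part_le_iff[of p "largest_part p"]
  by (simp add: sum_list_sum_nth atLeast0LessThan)

lemma sum_alternating_signs: "(\<Sum>i<n. (-1 :: int) ^ i) = (if odd n then 1 else 0)"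
  by (induction n) auto

lemma alt_sum_conjugate: "alt_sum (conjugate p) = int (length (filter odd p))"
proof -
  have "alt_sum (conjugate p) = (\<Sum>x\<leftarrow>p. \<Sum>i<x. (-1) ^ i)"
    using sum_mult_length_filter_less[of p "largest_part p" "\<lambda>i. (-1 :: int) ^ i"]
      largest_part_le_iff[of p "largest_part p"]
    by (simp add: alt_sum_def)
  also have "\<dots> = int (length (filter odd p))"
    unfolding sum_alternating_signs by (induction p) auto
  finally show ?thesis .
qed

lemma is_partition_conjugate: "is_partition (conjugate p)"
  unfolding is_partition_def
proof
  have "length (filter (\<lambda>x. j < x) p) \<le> length (filter (\<lambda>x. i < x) p)" if "i < j" for i j
    using that by (induction p) auto
  then show "sorted_wrt (\<ge>) (conjugate p)"
    by (auto simp: sorted_wrt_iff_nth_less)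
  show "\<forall>x\<in>set (conjugate p). 0 < x"
    by (auto simp: conjugate_def less_largest_part_iff filter_empty_conv)
qed

text \<open>In a non-increasing list the entries above \<open>i\<close> form an initial segment, so
  its length exceeds \<open>j\<close> exactly when position \<open>j\<close> lies in it. This is the
  reflection of a box in the diagonal.\<close>

lemma less_length_filter_less_iff:
  assumes "sorted_wrt (\<ge>) (p :: nat list)"
  shows "j < length (filter (\<lambda>x. i < x) p) \<longleftrightarrow> j < length p \<and> i < p ! j"
  using assms
proof (induction p arbitrary: j)
  case (Cons y p)
  show ?case
  proof (cases "i < y")
    case True
    with Cons show ?thesis by (cases j) auto
  next
    case False
    \<comment> \<open>The head is the largest entry, so no entry exceeds \<open>i\<close> and both
      sides are false.\<close>
    with Cons.prems have *: "\<not> i < x" if "x \<in> set (y # p)" for x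
      using that by auto
    then have "filter (\<lambda>x. i < x) (y # p) = []"
      by (simp add: filter_empty_conv)
    then show ?thesis
      using *[OF nth_mem, of j] by auto
  qed
qed simp

text \<open>Every column height counts some of the parts; column 0 counts all of them, since parts
  are positive.\<close>

lemma largest_part_conjugate:
  assumes "is_partition p"
  shows "largest_part (conjugate p) = length p"
proof (rule antisym)
  show "largest_part (conjugate p) \<le> length p"
    by (auto simp: largest_part_le_iff conjugate_def)
  show "length p \<le> largest_part (conjugate p)"
  \<comment> \<open>For the empty list there is no column 0 to look at.\<close>
  proof (cases "p = []")
    case False
    have pos: "\<forall>x\<in>set p. 0 < x"
      using assms by (simp add: is_partition_def)
    with False have *: "0 < largest_part p"
      by (auto simp: less_largest_part_iff neq_Nil_conv)
    have "conjugate p ! 0 = length p"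
      using * pos by (simp add: filter_id_conv)
    then have "length p \<in> set (conjugate p)"
      using * by (metis length_conjugate nth_mem)
    then show ?thesis
      by (simp add: largest_part_def)
  qed simp
qed

lemma conjugate_conjugate:
  assumes "is_partition p"
  shows "conjugate (conjugate p) = p"
proof (rule nth_equalityI)
  show "length (conjugate (conjugate p)) = length p"
    by (simp add: largest_part_conjugate assms)
next
  fix j
  assume "j < length (conjugate (conjugate p))"
  then have j: "j < length p"
    by (simp add: largest_part_conjugate assms)
  \<comment> \<open>Entry \<open>j\<close> of the double conjugate is the number of \<open>i\<close>
    satisfying the left side; the right side shows that there are \<open>p ! j\<close> of
    them.\<close>
  have "i < largest_part p \<and> j < conjugate p ! i \<longleftrightarrow> i < p ! j" for i
  proof (cases "i < largest_part p")
    case True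
    then show ?thesis
      using assms j by (simp add: is_partition_def less_length_filter_less_iff)
  next
    case False
    then show ?thesis
      using j by (auto simp: less_largest_part_iff)
  qed
  then have "{i. i < largest_part p \<and> j < conjugate p ! i} = {..<p ! j}"
    by auto
  then show "conjugate (conjugate p) ! j = p ! j"
    using j by (simp add: largest_part_conjugate assms length_filter_conv_card)
qed

theorem theorem5p6:
  fixes N n k :: nat
  shows "A_count N n k = B_count N n k"
proof -
  let ?A = "{p \<in> partitions_of n. length p \<le> N \<and> length (filter odd p) = k}"
  let ?B = "{p \<in> partitions_of n. (\<forall>x\<in>set p. x \<le> N) \<and> alt_sum p = int k}"
  have "bij_betw conjugate ?A ?B"
  proof (rule bij_betw_byWitness[where f' = conjugate])
    show "conjugate ` ?A \<subseteq> ?B"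
      by (auto simp: partitions_of_def is_partition_conjugate sum_list_conjugate
          alt_sum_conjugate largest_part_conjugate simp flip: largest_part_le_iff)
    \<comment> \<open>Since \<open>p\<close> is the conjugate of \<open>conjugate p\<close>, its
      alternating sum counts the odd parts of \<open>conjugate p\<close>.\<close>
    have "length (filter odd (conjugate p)) = k" if "is_partition p" "alt_sum p = int k" for p
      using that alt_sum_conjugate[of "conjugate p"] by (simp add: conjugate_conjugate)
    then show "conjugate ` ?B \<subseteq> ?A"
      by (auto simp: partitions_of_def is_partition_conjugate sum_list_conjugate
          largest_part_le_iff)
  qed (auto simp: partitions_of_def conjugate_conjugate)
  then show ?thesis
    by (simp add: A_count_def B_count_def bij_betw_same_card)
qed

end
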